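(* Let $g$ be a Riemannian metric on $\mathcal E$, $x_k\in\mathcal D$, $\alpha_k>0$, $\beta_k>0$, and let $$\mathcal L_{\beta_k}(x,\lambda)=f(x)-\langle\lambda,c(x)\rangle_{\mathcal F}+\tfrac{\beta_k}{2}\|c(x)\|_{\mathcal F}^2 .$$ Let $\lambda_k$ be the least-squares multiplier $$\lambda_k=\arg\min_{\lambda\in\mathcal F}\|\nabla_gf(x_k)-\mathrm Dc(x_k)^{*,g}\lambda\|_g^2=(\mathrm Dc(x_k)\mathrm Dc(x_k)^{*,g})^{-1}\mathrm Dc(x_k)\nabla_gf(x_k).$$ Then the augmented Lagrangian iteration $x_{k+1}=x_k-\alpha_k\nabla_g\mathcal L_{\beta_k}(x_k,\lambda_k)$ (unconstrained Riemannian gradient with respect to $x$) coincides with the landing iteration $$x_{k+1}=x_k+\alpha_k\big(d_T(x_k)+d_N(x_k)\big),\quad d_T(x)=-\mathrm{grad}^g_{\mathcal M_x}f(x),\quad d_N(x)=-\mathrm Dc(x)^{\dagger,g}H(x)c(x),$$ with $H(x_k)=\beta_k\,\mathrm Dc(x_k)\mathrm Dc(x_k)^{*,g}$.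
   Context: $\mathcal E,\mathcal F$ are finite-dimensional Euclidean spaces, $m=\dim\mathcal F<\dim\mathcal E$; $f:\mathcal E\to\mathbb R$, $c:\mathcal E\to\mathcal F$ are continuously differentiable; $\mathcal D=\{x:\operatorname{rank}\mathrm Dc(x)=m\}$; $\mathcal M_x=\{y:c(y)=c(x)\}$, $\mathrm T_x\mathcal M_x=\ker\mathrm Dc(x)$. $g_x(\xi,\zeta)=\langle G(x)\xi,\zeta\rangle_{\mathcal E}$ with $G(x)$ symmetric positive definite; $\|u\|_g=\sqrt{g(u,u)}$. $\nabla_gf(x)\in\mathcal E$ is defined by $g(\nabla_gf(x),\xi)=\mathrm Df(x)[\xi]$ for all $\xi\in\mathcal E$; $\mathrm{grad}^g_{\mathcal M_x}f(x)\in\mathrm T_x\mathcal M_x$ by the same identity for all $\xi\in\mathrm T_x\mathcal M_x$. $A^{*,g}$ is defined by $\langle A\xi,y\rangle_{\mathcal F}=g(\xi,A^{*,g}y)$, and $\mathrm Dc(x)^{\dagger,g}=\mathrm Dc(x)^{*,g}(\mathrm Dc(x)\mathrm Dc(x)^{*,g})^{-1}$. *)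

theory Defs
  imports "HOL-Analysis.Analysis"
begin

definition continuously_differentiable ::
    "('a::euclidean_space \<Rightarrow> 'b::euclidean_space) \<Rightarrow> bool" where
  "continuously_differentiable h \<longleftrightarrow>
     (\<exists>h' :: 'a \<Rightarrow> 'a \<Rightarrow>\<^sub>L 'b.
        (\<forall>x. (h has_derivative blinfun_apply (h' x)) (at x)) \<and> continuous_on UNIV h')"

abbreviation Dif :: "('a::euclidean_space \<Rightarrow> 'b::euclidean_space) \<Rightarrow> 'a \<Rightarrow> 'a \<Rightarrow> 'b" where
  "Dif h x \<equiv> frechet_derivative h (at x)"

definition full_rank_points :: "('e::euclidean_space \<Rightarrow> 'f::euclidean_space) \<Rightarrow> 'e set" where
  "full_rank_points c = {x. dim (range (Dif c x)) = DIM('f)}"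

text \<open>The tangent space at \<open>x\<close> of the layer \<open>{y. c y = c x}\<close>.\<close>

definition layer_tangent :: "('e::euclidean_space \<Rightarrow> 'f::euclidean_space) \<Rightarrow> 'e \<Rightarrow> 'e set" where
  "layer_tangent c x = {\<xi>. Dif c x \<xi> = 0}"

text \<open>A metric is represented by its field \<open>G\<close> of symmetric positive definite operators.
  No regularity of \<open>G\<close> in the base point is imposed, so smooth (or continuous)
  metrics are included as special cases.\<close>

definition riemannian_metric :: "('e::euclidean_space \<Rightarrow> 'e \<Rightarrow> 'e) \<Rightarrow> bool" where
  "riemannian_metric G \<longleftrightarrow>
     (\<forall>x. linear (G x) \<and> (\<forall>\<xi> \<zeta>. G x \<xi> \<bullet> \<zeta> = \<xi> \<bullet> G x \<zeta>) \<and> (\<forall>\<xi>. \<xi> \<noteq> 0 \<longrightarrow> G x \<xi> \<bullet> \<xi> > 0))"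

definition metric :: "('e::euclidean_space \<Rightarrow> 'e \<Rightarrow> 'e) \<Rightarrow> 'e \<Rightarrow> 'e \<Rightarrow> 'e \<Rightarrow> real" where
  "metric G x \<xi> \<zeta> = G x \<xi> \<bullet> \<zeta>"

definition metric_norm :: "('e::euclidean_space \<Rightarrow> 'e \<Rightarrow> 'e) \<Rightarrow> 'e \<Rightarrow> 'e \<Rightarrow> real" where
  "metric_norm G x u = sqrt (metric G x u u)"

definition metric_grad :: "('e::euclidean_space \<Rightarrow> 'e \<Rightarrow> 'e) \<Rightarrow> ('e \<Rightarrow> real) \<Rightarrow> 'e \<Rightarrow> 'e" where
  "metric_grad G f x = (THE u. \<forall>\<xi>. metric G x u \<xi> = Dif f x \<xi>)"

definition layer_grad ::
    "('e::euclidean_space \<Rightarrow> 'e \<Rightarrow> 'e) \<Rightarrow> ('e \<Rightarrow> 'f::euclidean_space) \<Rightarrow> ('e \<Rightarrow> real) \<Rightarrow> 'e \<Rightarrow> 'e" where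
  "layer_grad G c f x =
     (THE u. u \<in> layer_tangent c x \<and> (\<forall>\<xi>\<in>layer_tangent c x. metric G x u \<xi> = Dif f x \<xi>))"

definition metric_adjoint ::
    "('e::euclidean_space \<Rightarrow> 'e \<Rightarrow> 'e) \<Rightarrow> 'e \<Rightarrow> ('e \<Rightarrow> 'f::euclidean_space) \<Rightarrow> 'f \<Rightarrow> 'e" where
  "metric_adjoint G x A = (THE B. \<forall>\<xi> y. A \<xi> \<bullet> y = metric G x \<xi> (B y))"

text \<open>At points of full rank the operator inverted here is bijective, so \<open>inv\<close> is
  its two-sided inverse.\<close>

definition metric_pinv ::
    "('e::euclidean_space \<Rightarrow> 'e \<Rightarrow> 'e) \<Rightarrow> 'e \<Rightarrow> ('e \<Rightarrow> 'f::euclidean_space) \<Rightarrow> 'f \<Rightarrow> 'e" where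
  "metric_pinv G x A = metric_adjoint G x A \<circ> inv (A \<circ> metric_adjoint G x A)"

definition aug_lagrangian ::
    "('e::euclidean_space \<Rightarrow> real) \<Rightarrow> ('e \<Rightarrow> 'f::euclidean_space) \<Rightarrow> real \<Rightarrow> 'e \<Rightarrow> 'f \<Rightarrow> real" where
  "aug_lagrangian f c \<beta> x l = f x - l \<bullet> c x + \<beta> / 2 * (norm (c x))\<^sup>2"

definition ls_objective ::
    "('e::euclidean_space \<Rightarrow> 'e \<Rightarrow> 'e) \<Rightarrow> ('e \<Rightarrow> real) \<Rightarrow> ('e \<Rightarrow> 'f::euclidean_space) \<Rightarrow> 'e \<Rightarrow> 'f \<Rightarrow> real" where
  "ls_objective G f c x l =
     (metric_norm G x (metric_grad G f x - metric_adjoint G x (Dif c x) l))\<^sup>2"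

definition ls_multiplier ::
    "('e::euclidean_space \<Rightarrow> 'e \<Rightarrow> 'e) \<Rightarrow> ('e \<Rightarrow> real) \<Rightarrow> ('e \<Rightarrow> 'f::euclidean_space) \<Rightarrow> 'e \<Rightarrow> 'f" where
  "ls_multiplier G f c x = arg_min (ls_objective G f c x) (\<lambda>_. True)"

definition landing_tangent ::
    "('e::euclidean_space \<Rightarrow> 'e \<Rightarrow> 'e) \<Rightarrow> ('e \<Rightarrow> real) \<Rightarrow> ('e \<Rightarrow> 'f::euclidean_space) \<Rightarrow> 'e \<Rightarrow> 'e" where
  "landing_tangent G f c x = - layer_grad G c f x"

definition landing_normal ::
    "('e::euclidean_space \<Rightarrow> 'e \<Rightarrow> 'e) \<Rightarrow> ('e \<Rightarrow> 'f::euclidean_space) \<Rightarrow> ('e \<Rightarrow> 'f \<Rightarrow> 'f) \<Rightarrow> 'e \<Rightarrow> 'e" where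
  "landing_normal G c H x = - metric_pinv G x (Dif c x) (H x (c x))"

end

theory Submission
  imports Defs
begin

text \<open>Write \<open>A\<close> for the derivative of \<open>c\<close>, \<open>B\<close> for its metric adjoint and \<open>u\<close> for the metric
  gradient of \<open>f\<close>, all at \<open>x\<^sub>k\<close>. Full rank makes \<open>A B\<close> invertible, so there is a unique \<open>\<lambda>\<close> with
  \<open>A (u - B \<lambda>) = 0\<close>. Since \<open>range B\<close> is the metric complement of \<open>ker A\<close>, the vector \<open>u - B \<lambda>\<close> is
  the projection of \<open>u\<close> onto the tangent space, that is, the layer gradient, and \<open>\<lambda>\<close> is the least
  squares multiplier by Pythagoras. The metric gradient of the augmented Lagrangian is
  \<open>u - B \<lambda> + \<beta> B (c x)\<close>, and the pseudoinverse applied to \<open>\<beta> A B (c x)\<close> is \<open>\<beta> B (c x)\<close>.\<close>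

context
  fixes G :: "'e::euclidean_space \<Rightarrow> 'e \<Rightarrow> 'e"
  assumes G: "riemannian_metric G"
begin

section \<open>The metric at a point as an inner product\<close>

lemma linear_metric: "linear (G x)"
  using G by (simp add: riemannian_metric_def)

lemma metric_commute: "metric G x a b = metric G x b a"
  using G unfolding riemannian_metric_def metric_def by (metis inner_commute)

lemma bilinear_metric: "bilinear (metric G x)"
  unfolding bilinear_def metric_def
  by (auto intro!: linearI simp: inner_add_left inner_add_right linear_add[OF linear_metric]
      linear_scale[OF linear_metric])

lemmas metric_simps =
  bilinear_ladd[OF bilinear_metric] bilinear_radd[OF bilinear_metric]
  bilinear_lsub[OF bilinear_metric] bilinear_rsub[OF bilinear_metric]
  bilinear_lmul[OF bilinear_metric] bilinear_rmul[OF bilinear_metric]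
  bilinear_lzero[OF bilinear_metric] bilinear_rzero[OF bilinear_metric]

lemma metric_pos: "a \<noteq> 0 \<Longrightarrow> 0 < metric G x a a"
  using G unfolding riemannian_metric_def metric_def by blast

lemma metric_nonneg: "0 \<le> metric G x a a"
  using metric_pos[of a x] by (cases "a = 0") (simp_all add: metric_simps)

lemma metric_eq_0_iff: "metric G x a a = 0 \<longleftrightarrow> a = 0"
  using metric_pos[of a x] by (cases "a = 0") (simp_all add: metric_simps)

lemma metric_norm_power2: "(metric_norm G x a)\<^sup>2 = metric G x a a"
  by (simp add: metric_norm_def metric_nonneg)

lemma metric_left_eqI:
  assumes "\<And>\<xi>. metric G x u \<xi> = metric G x v \<xi>"
  shows "u = v"
  using assms[of "u - v"] metric_eq_0_iff[of x "u - v"] by (simp add: metric_simps)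

lemma metric_right_eqI:
  assumes "\<And>\<xi>. metric G x \<xi> u = metric G x \<xi> v"
  shows "u = v"
  using assms by (metis metric_commute metric_left_eqI)

lemma surj_metric: "surj (G x)"
proof -
  have "inj (G x)"
    unfolding linear_injective_0[OF linear_metric]
    by (metis metric_eq_0_iff metric_def inner_zero_left)
  then show ?thesis
    by (simp add: linear_inj_imp_surj[OF linear_metric])
qed

section \<open>Riesz representation, gradients and adjoints\<close>

lemma metric_riesz:
  fixes \<phi> :: "'e \<Rightarrow> real"
  assumes "linear \<phi>"
  shows "\<exists>!u. \<forall>\<xi>. metric G x u \<xi> = \<phi> \<xi>"
proof (rule ex_ex1I)
  \<comment> \<open>As \<phi> is real-valued, \<open>adjoint \<phi> 1\<close> is its Euclidean Riesz
    vector; solving with \<open>G x\<close> converts it to a metric one.\<close>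
  obtain u where "G x u = adjoint \<phi> 1"
    using surjD[OF surj_metric, of "adjoint \<phi> 1" x] by metis
  then have "\<forall>\<xi>. metric G x u \<xi> = \<phi> \<xi>"
    using adjoint_works[OF assms, of _ 1] by (simp add: metric_def inner_commute)
  then show "\<exists>u. \<forall>\<xi>. metric G x u \<xi> = \<phi> \<xi>" ..
next
  fix u v assume "\<forall>\<xi>. metric G x u \<xi> = \<phi> \<xi>" "\<forall>\<xi>. metric G x v \<xi> = \<phi> \<xi>"
  then show "u = v"
    by (intro metric_left_eqI[of x]) simp
qed

lemma metric_grad_works:
  assumes "h differentiable at x"
  shows "metric G x (metric_grad G h x) \<xi> = Dif h x \<xi>"
  using theI'[OF metric_riesz[OF linear_frechet_derivative[OF assms], of x]]
  unfolding metric_grad_def by blast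

lemma metric_grad_eqI:
  assumes "\<And>\<xi>. metric G x u \<xi> = Dif h x \<xi>"
  shows "metric_grad G h x = u"
  unfolding metric_grad_def
proof (rule the_equality)
  fix v assume "\<forall>\<xi>. metric G x v \<xi> = Dif h x \<xi>"
  then show "v = u"
    using assms by (intro metric_left_eqI[of x]) simp
qed (use assms in blast)

text \<open>The definite description ranges over whole maps, so the Riesz vectors for the individual
  \<open>y\<close> are first assembled into one map \<open>B\<close>.\<close>

lemma metric_adjoint_works:
  fixes A :: "'e \<Rightarrow> 'f::euclidean_space"
  assumes "linear A"
  shows "metric G x \<xi> (metric_adjoint G x A y) = A \<xi> \<bullet> y"
proof -
  have "\<exists>b. \<forall>\<xi>. metric G x b \<xi> = A \<xi> \<bullet> y" for y
    using metric_riesz[of "\<lambda>\<xi>. A \<xi> \<bullet> y" x] assms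
    by (auto simp: linear_iff inner_add_left)
  then obtain B where B: "\<And>y \<xi>. metric G x (B y) \<xi> = A \<xi> \<bullet> y"
    by metis
  have "metric_adjoint G x A = B"
    unfolding metric_adjoint_def
  proof (rule the_equality)
    show "\<forall>\<xi> y. A \<xi> \<bullet> y = metric G x \<xi> (B y)"
      using B by (simp add: metric_commute)
  next
    fix C assume "\<forall>\<xi> y. A \<xi> \<bullet> y = metric G x \<xi> (C y)"
    then show "C = B"
      using B by (intro ext metric_left_eqI[of x]) (simp add: metric_commute)
  qed
  then show ?thesis
    using B by (simp add: metric_commute)
qed

lemma linear_metric_adjoint:
  fixes A :: "'e \<Rightarrow> 'f::euclidean_space"
  assumes "linear A"
  shows "linear (metric_adjoint G x A)"
  by (rule linearI; rule metric_right_eqI[of x];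
      simp add: metric_simps metric_adjoint_works[OF assms] inner_add_right)

text \<open>If \<open>A (B y) = 0\<close>, pairing with \<open>y\<close> gives the squared metric
  norm of \<open>B y\<close>, so \<open>B y = 0\<close>. Then \<open>y\<close> is orthogonal to the
  range of \<open>A\<close>, which is the whole space.\<close>

lemma bij_comp_metric_adjoint:
  fixes A :: "'e \<Rightarrow> 'f::euclidean_space"
  assumes A: "linear A" and "surj A"
  shows "bij (A \<circ> metric_adjoint G x A)"
proof -
  let ?B = "metric_adjoint G x A"
  have lin: "linear (A \<circ> ?B)"
    by (intro linear_compose linear_metric_adjoint A)
  have "inj (A \<circ> ?B)"
    unfolding linear_injective_0[OF lin]
  proof (intro allI impI)
    fix y assume "(A \<circ> ?B) y = 0"
    then have "?B y = 0"
      using metric_adjoint_works[OF A, of x "?B y" y] metric_eq_0_iff[of x "?B y"] by simp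
    then have "A \<xi> \<bullet> y = 0" for \<xi>
      using metric_adjoint_works[OF A, of x \<xi> y] by (simp add: metric_simps)
    then show "y = 0"
      using surjD[OF \<open>surj A\<close>, of y] by (metis inner_eq_zero_iff)
  qed
  then show ?thesis
    using linear_inj_imp_surj[OF lin] by (simp add: bij_def)
qed

lemma metric_pinv_comp_adjoint:
  fixes A :: "'e \<Rightarrow> 'f::euclidean_space"
  assumes "linear A" "surj A"
  shows "metric_pinv G x A (A (metric_adjoint G x A y)) = metric_adjoint G x A y"
  using inv_f_f[OF bij_is_inj[OF bij_comp_metric_adjoint[OF assms]], of x y]
  by (simp add: metric_pinv_def)

lemma layer_grad_eqI:
  assumes "c differentiable at x" "u \<in> layer_tangent c x"
    and "\<And>\<xi>. \<xi> \<in> layer_tangent c x \<Longrightarrow> metric G x u \<xi> = Dif h x \<xi>"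
  shows "layer_grad G c h x = u"
  unfolding layer_grad_def
proof (rule the_equality)
  fix v assume v: "v \<in> layer_tangent c x \<and> (\<forall>\<xi>\<in>layer_tangent c x. metric G x v \<xi> = Dif h x \<xi>)"
  \<comment> \<open>The difference of two candidates is tangent, so it may serve as its own test
    vector.\<close>
  then have "v - u \<in> layer_tangent c x"
    using assms(2) linear_diff[OF linear_frechet_derivative[OF assms(1)]]
    by (simp add: layer_tangent_def)
  then have "metric G x (v - u) (v - u) = 0"
    using v assms(3) by (simp add: metric_simps(3))
  then show "v = u"
    by (simp add: metric_eq_0_iff)
qed (use assms in auto)

section \<open>The augmented Lagrangian and the least-squares residual at one point\<close>

context
  fixes f :: "'e \<Rightarrow> real" and c :: "'e \<Rightarrow> 'f::euclidean_space" and x :: 'e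
  assumes f: "f differentiable at x" and c: "c differentiable at x"
begin

lemma metric_grad_aug_lagrangian:
  "metric_grad G (\<lambda>x. aug_lagrangian f c \<beta> x l) x =
     metric_grad G f x - metric_adjoint G x (Dif c x) l
       + \<beta> *\<^sub>R metric_adjoint G x (Dif c x) (c x)"
proof (rule metric_grad_eqI)
  fix \<xi>
  have der: "((\<lambda>x. aug_lagrangian f c \<beta> x l) has_derivative
      (\<lambda>\<xi>. Dif f x \<xi> - l \<bullet> Dif c x \<xi> + \<beta> * (c x \<bullet> Dif c x \<xi>))) (at x)"
    unfolding aug_lagrangian_def power2_norm_eq_inner
    using f c unfolding frechet_derivative_works
    by (auto intro!: derivative_eq_intros simp: inner_commute)
  have "Dif (\<lambda>x. aug_lagrangian f c \<beta> x l) x \<xi> =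
      Dif f x \<xi> - l \<bullet> Dif c x \<xi> + \<beta> * (c x \<bullet> Dif c x \<xi>)"
    using fun_cong[OF frechet_derivative_at[OF der], of \<xi>] by simp
  then show "metric G x (metric_grad G f x - metric_adjoint G x (Dif c x) l
       + \<beta> *\<^sub>R metric_adjoint G x (Dif c x) (c x)) \<xi> = Dif (\<lambda>x. aug_lagrangian f c \<beta> x l) x \<xi>"
    using metric_adjoint_works[OF linear_frechet_derivative[OF c], of x \<xi>]
    by (simp add: metric_simps metric_grad_works[OF f] inner_commute
        metric_commute[of x "metric_adjoint G x (Dif c x) _" \<xi>])
qed

context
  fixes \<mu> :: 'f
  assumes \<mu>: "Dif c x (metric_grad G f x - metric_adjoint G x (Dif c x) \<mu>) = 0"
begin

text \<open>The condition on \<mu> is the normal equation, which makes the residual tangent. The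
  subtracted term is metric-orthogonal to the kernel of the derivative, so tangential pairings do
  not change.\<close>

lemma layer_grad_eq_residual:
  "layer_grad G c f x = metric_grad G f x - metric_adjoint G x (Dif c x) \<mu>"
proof (rule layer_grad_eqI[OF c])
  fix \<xi> assume "\<xi> \<in> layer_tangent c x"
  then show "metric G x (metric_grad G f x - metric_adjoint G x (Dif c x) \<mu>) \<xi> = Dif f x \<xi>"
    using metric_adjoint_works[OF linear_frechet_derivative[OF c], of x \<xi> \<mu>]
    by (simp add: metric_simps metric_grad_works[OF f] layer_tangent_def
        metric_commute[of x "metric_adjoint G x (Dif c x) _" \<xi>])
qed (simp add: layer_tangent_def \<mu>)

text \<open>The residual at \<mu> lies in the kernel of the derivative, hence is metric-orthogonal
  to the range of the adjoint, and the cross terms vanish.\<close>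

lemma ls_objective_pythagoras:
  "ls_objective G f c x l =
     ls_objective G f c x \<mu> + (metric_norm G x (metric_adjoint G x (Dif c x) (l - \<mu>)))\<^sup>2"
proof -
  let ?B = "metric_adjoint G x (Dif c x)"
  let ?r = "metric_grad G f x - ?B \<mu>"
  note A = linear_frechet_derivative[OF c]
  have eq: "metric_grad G f x - ?B l = ?r - ?B (l - \<mu>)"
    by (simp add: linear_diff[OF linear_metric_adjoint[OF A]])
  have "metric G x ?r (?B (l - \<mu>)) = 0"
    using \<mu> by (simp add: metric_adjoint_works[OF A])
  moreover from this have "metric G x (?B (l - \<mu>)) ?r = 0"
    by (simp add: metric_commute)
  ultimately show ?thesis
    unfolding ls_objective_def metric_norm_power2 eq metric_simps(3,4)[of x ?r "?B (l - \<mu>)"]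
    by (simp only: metric_simps(3)[of x ?r] metric_simps(4)[of x _ ?r])
qed

lemma is_arg_min_ls_objective_iff:
  assumes "surj (Dif c x)"
  shows "is_arg_min (ls_objective G f c x) (\<lambda>_. True) l \<longleftrightarrow> l = \<mu>"
proof
  note A = linear_frechet_derivative[OF c]
  let ?B = "metric_adjoint G x (Dif c x)"
  assume "is_arg_min (ls_objective G f c x) (\<lambda>_. True) l"
  then have "ls_objective G f c x l \<le> ls_objective G f c x \<mu>"
    by (simp add: is_arg_min_linorder)
  then have "(metric_norm G x (?B (l - \<mu>)))\<^sup>2 \<le> 0"
    using ls_objective_pythagoras[of l] by linarith
  then have "?B l = ?B \<mu>"
    using metric_eq_0_iff[of x "?B (l - \<mu>)"] metric_nonneg[of x "?B (l - \<mu>)"]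
    unfolding metric_norm_power2 by (simp add: linear_diff[OF linear_metric_adjoint[OF A]])
  \<comment> \<open>The adjoint is injective because its composition with the derivative is.\<close>
  then show "l = \<mu>"
    using injD[OF bij_is_inj[OF bij_comp_metric_adjoint[OF A assms]], of x l \<mu>] by simp
next
  have "ls_objective G f c x \<mu> \<le> ls_objective G f c x l'" for l'
    using ls_objective_pythagoras[of l'] by simp
  moreover assume "l = \<mu>"
  ultimately show "is_arg_min (ls_objective G f c x) (\<lambda>_. True) l"
    by (simp add: is_arg_min_linorder)
qed

end

end

end

theorem proposition5p1:
  fixes f :: "'e::euclidean_space \<Rightarrow> real"
    and c :: "'e \<Rightarrow> 'f::euclidean_space"
    and G :: "'e \<Rightarrow> 'e \<Rightarrow> 'e"
    and H :: "'e \<Rightarrow> 'f \<Rightarrow> 'f"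
    and x\<^sub>k :: 'e
    and \<alpha>\<^sub>k \<beta>\<^sub>k :: real
  assumes "DIM('f) < DIM('e)"
    and "continuously_differentiable f"
    and "continuously_differentiable c"
    and "riemannian_metric G"
    and "x\<^sub>k \<in> full_rank_points c"
    and "\<alpha>\<^sub>k > 0"
    and "\<beta>\<^sub>k > 0"
    and "H x\<^sub>k = (\<lambda>y. \<beta>\<^sub>k *\<^sub>R Dif c x\<^sub>k (metric_adjoint G x\<^sub>k (Dif c x\<^sub>k) y))"
  shows "(\<forall>l. is_arg_min (ls_objective G f c x\<^sub>k) (\<lambda>_. True) l \<longleftrightarrow> l = ls_multiplier G f c x\<^sub>k)
    \<and> ls_multiplier G f c x\<^sub>k =
        inv (Dif c x\<^sub>k \<circ> metric_adjoint G x\<^sub>k (Dif c x\<^sub>k)) (Dif c x\<^sub>k (metric_grad G f x\<^sub>k))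
    \<and> x\<^sub>k - \<alpha>\<^sub>k *\<^sub>R metric_grad G (\<lambda>x. aug_lagrangian f c \<beta>\<^sub>k x (ls_multiplier G f c x\<^sub>k)) x\<^sub>k =
        x\<^sub>k + \<alpha>\<^sub>k *\<^sub>R (landing_tangent G f c x\<^sub>k + landing_normal G c H x\<^sub>k)"
proof -
  note G = \<open>riemannian_metric G\<close>
  let ?A = "Dif c x\<^sub>k"
  let ?B = "metric_adjoint G x\<^sub>k ?A"
  let ?u = "metric_grad G f x\<^sub>k"
  define \<mu> where "\<mu> = inv (?A \<circ> ?B) (?A ?u)"
  have f: "f differentiable at x\<^sub>k" and c: "c differentiable at x\<^sub>k"
    using assms(2,3) unfolding continuously_differentiable_def differentiable_def by blast+
  note A = linear_frechet_derivative[OF c]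
  \<comment> \<open>The range is a subspace of full dimension, hence everything.\<close>
  have surj: "surj ?A"
    using assms(5) linear_subspace_image[OF A subspace_UNIV]
    by (metis (mono_tags, lifting) full_rank_points_def mem_Collect_eq dim_eq_full span_eq_iff)
  have "?A (?B \<mu>) = ?A ?u"
    using surj_f_inv_f[OF bij_is_surj[OF bij_comp_metric_adjoint[OF G A surj]], of x\<^sub>k "?A ?u"]
    by (simp add: \<mu>_def)
  then have \<mu>: "?A (?u - ?B \<mu>) = 0"
    by (simp add: linear_diff[OF A])
  note argmin = is_arg_min_ls_objective_iff[OF G f c \<mu> surj]
  \<comment> \<open>\<open>arg_min\<close> is a choice among minimizers; uniqueness determines its
    value.\<close>
  have ls: "ls_multiplier G f c x\<^sub>k = \<mu>"
    by (simp add: ls_multiplier_def arg_min_def argmin)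
  \<comment> \<open>By linearity \<open>H\<close> applied to \<open>c\<close> is
    \<open>?A (?B y)\<close> with \<open>y\<close> the constraint value scaled by
    \<open>\<beta>\<^sub>k\<close>, so the inverse in the pseudoinverse cancels.\<close>
  have "landing_normal G c H x\<^sub>k = - (\<beta>\<^sub>k *\<^sub>R ?B (c x\<^sub>k))"
    using metric_pinv_comp_adjoint[OF G A surj, of x\<^sub>k "\<beta>\<^sub>k *\<^sub>R c x\<^sub>k"]
    by (simp add: landing_normal_def assms(8) linear_scale[OF A]
        linear_scale[OF linear_metric_adjoint[OF G A]])
  then show ?thesis
    using argmin
    by (simp add: ls \<mu>_def[symmetric] landing_tangent_def layer_grad_eq_residual[OF G f c \<mu>]
        metric_grad_aug_lagrangian[OF G f c] algebra_simps)
qed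

end
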